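(* Let $0<\alpha<1$, let $X(t)=\int_Ef_t(x)\,M(dx)$, $t\in T\subset\mathbb{R}^d$, be an $\alpha$-stable random field, where $M$ is an $\alpha$-stable random measure with control measure $m$ and $\int_E|f_t|^\alpha dm<\infty$ for every $t\in T$. Let $t_1,\ldots,t_n\in T$ be such that $f_{t_1},\ldots,f_{t_n}$ are linearly independent (as elements of $L^\alpha(E,m)$). Then the best LSL predictor based on $X(t_1),\ldots,X(t_n)$ is exact: if $t=t_i$ for some $i\in\{1,\ldots,n\}$, then the best LSL predictor satisfies $\widehat X(t)=X(t)$ almost surely.
   Context: $(E,\mathcal{E},m)$ is a measurable space with $\sigma$-finite measure $m$; an $\alpha$-stable random measure $M$ with control measure $m$ and measurable skewness function $\beta:E\to[-1,1]$ is an independently scattered, a.s. $\sigma$-additive random function on the sets $A$ of finite $m$-measure such that $M(A)$ has the $\alpha$-stable law with scale $m(A)^{1/\alpha}$, skewness $\int_A\beta\,dm/m(A)$ and shift $0$. Best LSL predictor of $X(t)$, $t\in T$: first reorder the points so that $\|t-t_1\|\le\cdots\le\|t-t_n\|$ (Euclidean norm), with ties $\|t-t_i\|=\|t-t_{i+1}\|$ broken lexicographically (for some $k\in\{1,\ldots,d\}$, $t_i^{(p)}=t_{i+1}^{(p)}$ for $p<k$ and $t_i^{(k)}<t_{i+1}^{(k)}$, superscripts denoting coordinates). Put $$H_\alpha(\lambda)=\Big(\int_E\Big|f_t(x)-\sum_{i=1}^n\lambda_if_{t_i}(x)\Big|^\alpha m(dx)\Big)^{1/\alpha},\quad\lambda\in\mathbb{R}^n,$$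 $A_0=\{\lambda\in\mathbb{R}^n:H_\alpha(\lambda)=\inf_{\mu\in\mathbb{R}^n}H_\alpha(\mu)\}$ and $A_j=\{\lambda\in A_{j-1}:\lambda_j=\max_{\mu\in A_{j-1}}\mu_j\}$ for $j=1,\ldots,n$. The set $A_n$ consists of a single element $(\lambda_1^*,\ldots,\lambda_n^* )$, and the best LSL predictor is $\widehat X(t)=\sum_{i=1}^n\lambda_i^*X(t_i)$. *)

theory Defs
  imports "HOL-Probability.Probability"
begin

section \<open>Stable random measures and integrals\<close>

text \<open>Characteristic function of the stable law with scale \<open>\<sigma>\<close>, skewness \<open>b\<close> and shift \<open>\<mu>\<close>, in
  the parametrization of Samorodnitsky and Taqqu.  Since \<open>0 powr \<alpha> = 0\<close>, the value at
  \<open>\<theta> = 0\<close> is 1 and \<open>\<sigma> = 0\<close> gives the point mass at \<open>\<mu>\<close>.\<close>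

definition stable_char :: "real \<Rightarrow> real \<Rightarrow> real \<Rightarrow> real \<Rightarrow> real \<Rightarrow> complex" where
  "stable_char \<alpha> \<sigma> b \<mu> \<theta> =
     exp (- of_real (\<sigma> powr \<alpha> * \<bar>\<theta>\<bar> powr \<alpha>) *
            (1 - \<i> * of_real (b * sgn \<theta> *
               (if \<alpha> = 1 then - (2 / pi) * ln \<bar>\<theta>\<bar> else tan (pi * \<alpha> / 2))))
          + \<i> * of_real (\<mu> * \<theta>))"

definition has_stable_law ::
    "'w measure \<Rightarrow> ('w \<Rightarrow> real) \<Rightarrow> real \<Rightarrow> real \<Rightarrow> real \<Rightarrow> real \<Rightarrow> bool" where
  "has_stable_law P Y \<alpha> \<sigma> b \<mu> \<longleftrightarrow>
     Y \<in> borel_measurable P \<and> char (distr P borel Y) = stable_char \<alpha> \<sigma> b \<mu>"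

definition finite_measure_sets :: "'e measure \<Rightarrow> 'e set set" where
  "finite_measure_sets m = {A \<in> sets m. emeasure m A < \<infinity>}"

text \<open>If \<open>m(A) = 0\<close>, the scale is 0 and the skewness (then \<open>0 / 0 = 0\<close>) is irrelevant.  The last
  clause implies finite additivity, as the union may be filled up with empty sets.\<close>

definition stable_random_measure ::
    "'w measure \<Rightarrow> 'e measure \<Rightarrow> real \<Rightarrow> ('e \<Rightarrow> real) \<Rightarrow> ('e set \<Rightarrow> 'w \<Rightarrow> real) \<Rightarrow> bool" where
  "stable_random_measure P m \<alpha> \<beta> M \<longleftrightarrow>
     \<beta> \<in> borel_measurable m \<and> (\<forall>x\<in>space m. -1 \<le> \<beta> x \<and> \<beta> x \<le> 1) \<and>
     (\<forall>A\<in>finite_measure_sets m.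
        has_stable_law P (M A) \<alpha> (measure m A powr (1 / \<alpha>)) ((LINT x:A|m. \<beta> x) / measure m A) 0) \<and>
     (\<forall>(k::nat) A. A ` {..<k} \<subseteq> finite_measure_sets m \<and> disjoint_family_on A {..<k} \<longrightarrow>
        prob_space.indep_vars P (\<lambda>_. borel) (\<lambda>i. M (A i)) {..<k}) \<and>
     (\<forall>A :: nat \<Rightarrow> 'e set. range A \<subseteq> finite_measure_sets m \<and> disjoint_family A \<and>
        (\<Union>i. A i) \<in> finite_measure_sets m \<longrightarrow>
        (AE \<omega> in P. (\<lambda>i. M (A i) \<omega>) sums M (\<Union>i. A i) \<omega>))"

definition Lalpha :: "real \<Rightarrow> 'e measure \<Rightarrow> ('e \<Rightarrow> real) set" where
  "Lalpha \<alpha> m = {g \<in> borel_measurable m. integrable m (\<lambda>x. \<bar>g x\<bar> powr \<alpha>)}"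

text \<open>Integral of a simple function whose support has finite measure.  The value 0 is left out
  because its level set may have infinite measure, where \<open>M\<close> is not specified.\<close>

definition simple_stable_integral ::
    "'e measure \<Rightarrow> ('e set \<Rightarrow> 'w \<Rightarrow> real) \<Rightarrow> ('e \<Rightarrow> real) \<Rightarrow> 'w \<Rightarrow> real" where
  "simple_stable_integral m M s \<omega> =
     (\<Sum>y\<in>s ` space m - {0}. y * M {x \<in> space m. s x = y} \<omega>)"

definition tendsto_in_probability ::
    "'w measure \<Rightarrow> (nat \<Rightarrow> 'w \<Rightarrow> real) \<Rightarrow> ('w \<Rightarrow> real) \<Rightarrow> bool" where
  "tendsto_in_probability P Z Y \<longleftrightarrow>
     (\<forall>\<epsilon>>0. (\<lambda>k. measure P {\<omega> \<in> space P. \<bar>Z k \<omega> - Y \<omega>\<bar> > \<epsilon>}) \<longlonglongrightarrow> 0)"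

text \<open>\<open>Y\<close> is a version of \<open>\<integral> g dM\<close>: the limit in probability of integrals of simple functions that
  approximate \<open>g\<close> in \<open>L\<^sup>\<alpha>\<close>.  This determines \<open>Y\<close> only up to almost sure equality, hence a
  relation.  For \<open>\<alpha> = 1\<close> and nonzero skewness a different mode of approximation would be needed.\<close>

definition has_stable_integral ::
    "'w measure \<Rightarrow> 'e measure \<Rightarrow> real \<Rightarrow> ('e set \<Rightarrow> 'w \<Rightarrow> real) \<Rightarrow> ('e \<Rightarrow> real) \<Rightarrow> ('w \<Rightarrow> real) \<Rightarrow> bool"
  where
  "has_stable_integral P m \<alpha> M g Y \<longleftrightarrow>
     g \<in> Lalpha \<alpha> m \<and> Y \<in> borel_measurable P \<and>
     (\<exists>s. (\<forall>k. simple_function m (s k) \<and> {x \<in> space m. s k x \<noteq> 0} \<in> finite_measure_sets m) \<and>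
          (\<lambda>k. \<integral>\<^sup>+x. ennreal (\<bar>s k x - g x\<bar> powr \<alpha>) \<partial>m) \<longlonglongrightarrow> 0 \<and>
          tendsto_in_probability P (\<lambda>k. simple_stable_integral m M (s k)) Y)"


section \<open>The best LSL predictor\<close>

text \<open>Linear independence in \<open>L\<^sup>\<alpha>(m)\<close>, whose elements are functions modulo equality
  almost everywhere.\<close>

definition lin_indep_AE :: "'e measure \<Rightarrow> nat \<Rightarrow> (nat \<Rightarrow> 'e \<Rightarrow> real) \<Rightarrow> bool" where
  "lin_indep_AE m n g \<longleftrightarrow>
     (\<forall>c :: nat \<Rightarrow> real. (AE x in m. (\<Sum>i=1..n. c i * g i x) = 0) \<longrightarrow> (\<forall>i\<in>{1..n}. c i = 0))"

text \<open>\<open>(real, 'd) vec\<close> is \<open>real ^ 'd\<close>; the index type is linearly ordered so that the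
  coordinates can be compared lexicographically.\<close>

definition lex_less :: "(real, 'd::{finite,linorder}) vec \<Rightarrow> (real, 'd) vec \<Rightarrow> bool" where
  "lex_less u v \<longleftrightarrow> (\<exists>k. (\<forall>p<k. u $ p = v $ p) \<and> u $ k < v $ k)"

definition LSL_ordered ::
    "(real, 'd::{finite,linorder}) vec \<Rightarrow> nat \<Rightarrow> (nat \<Rightarrow> (real, 'd) vec) \<Rightarrow> bool" where
  "LSL_ordered t n q \<longleftrightarrow>
     (\<forall>i\<in>{1..<n}. norm (t - q i) \<le> norm (t - q (Suc i)) \<and>
        (norm (t - q i) = norm (t - q (Suc i)) \<longrightarrow> lex_less (q i) (q (Suc i))))"

text \<open>The reordering is unique if the points \<open>ts 1, \<dots>, ts n\<close> are distinct.\<close>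

definition LSL_reorder ::
    "(real, 'd::{finite,linorder}) vec \<Rightarrow> nat \<Rightarrow> (nat \<Rightarrow> (real, 'd) vec) \<Rightarrow> nat \<Rightarrow> (real, 'd) vec" where
  "LSL_reorder t n ts = ts \<circ> (THE \<pi>. \<pi> permutes {1..n} \<and> LSL_ordered t n (ts \<circ> \<pi>))"

text \<open>Vectors in \<open>\<real>\<^sup>n\<close> are extensional functions on \<open>{1..n}\<close>.\<close>

abbreviation Rn :: "nat \<Rightarrow> (nat \<Rightarrow> real) set" where
  "Rn n \<equiv> {1..n} \<rightarrow>\<^sub>E UNIV"

definition LSL_H ::
    "real \<Rightarrow> 'e measure \<Rightarrow> ('t \<Rightarrow> 'e \<Rightarrow> real) \<Rightarrow> 't \<Rightarrow> nat \<Rightarrow> (nat \<Rightarrow> 't) \<Rightarrow> (nat \<Rightarrow> real) \<Rightarrow> real" where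
  "LSL_H \<alpha> m f t n q l =
     (LINT x|m. \<bar>f t x - (\<Sum>i=1..n. l i * f (q i) x)\<bar> powr \<alpha>) powr (1 / \<alpha>)"

primrec LSL_A ::
    "real \<Rightarrow> 'e measure \<Rightarrow> ('t \<Rightarrow> 'e \<Rightarrow> real) \<Rightarrow> 't \<Rightarrow> nat \<Rightarrow> (nat \<Rightarrow> 't) \<Rightarrow> nat \<Rightarrow> (nat \<Rightarrow> real) set"
  where
  "LSL_A \<alpha> m f t n q 0 =
     {l \<in> Rn n. LSL_H \<alpha> m f t n q l = (INF u\<in>Rn n. LSL_H \<alpha> m f t n q u)}"
| "LSL_A \<alpha> m f t n q (Suc j) =
     {l \<in> LSL_A \<alpha> m f t n q j. \<forall>u\<in>LSL_A \<alpha> m f t n q j. u (Suc j) \<le> l (Suc j)}"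

definition LSL_coeff ::
    "real \<Rightarrow> 'e measure \<Rightarrow> ('t \<Rightarrow> 'e \<Rightarrow> real) \<Rightarrow> 't \<Rightarrow> nat \<Rightarrow> (nat \<Rightarrow> 't) \<Rightarrow> nat \<Rightarrow> real" where
  "LSL_coeff \<alpha> m f t n q = the_elem (LSL_A \<alpha> m f t n q n)"

definition best_LSL_predictor ::
    "real \<Rightarrow> 'e measure \<Rightarrow> ((real, 'd::{finite,linorder}) vec \<Rightarrow> 'e \<Rightarrow> real) \<Rightarrow> ((real, 'd) vec \<Rightarrow> 'w \<Rightarrow> real) \<Rightarrow>
     nat \<Rightarrow> (nat \<Rightarrow> (real, 'd) vec) \<Rightarrow> (real, 'd) vec \<Rightarrow> 'w \<Rightarrow> real" where
  "best_LSL_predictor \<alpha> m f X n ts t \<omega> =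
     (let q = LSL_reorder t n ts in \<Sum>i=1..n. LSL_coeff \<alpha> m f t n q i * X (q i) \<omega>)"

end

(* Linear independence makes the f (ts i) pairwise distinct modulo null sets, so the points ts i are
   distinct and have exactly one reordering q.  With t = q j, the criterion vanishes at the unit
   vector e_j, and by linear independence nowhere else; hence every A_k is {e_j}, and the predictor
   is X (q j). *)

theory Submission
  imports Defs
begin

section \<open>Uniqueness of the reordering\<close>

lemma lex_less_irrefl: "\<not> lex_less u u"
  unfolding lex_less_def by blast

lemma lex_less_trans: "lex_less u v \<Longrightarrow> lex_less v w \<Longrightarrow> lex_less u w"
proof -
  assume "lex_less u v" "lex_less v w"
  then obtain k l where k: "\<forall>p<k. u $ p = v $ p" "u $ k < v $ k"
    and l: "\<forall>p<l. v $ p = w $ p" "v $ l < w $ l"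
    by (auto simp: lex_less_def)
  show "lex_less u w"
    unfolding lex_less_def
  \<comment> \<open>The deciding positions may differ. Both pairs agree below the smaller one; there
    one comparison is strict and the other is strict or an equality.\<close>
  proof (intro exI[of _ "min k l"] conjI allI impI)
    show "u $ p = w $ p" if "p < min k l" for p
      using k l that by auto
    show "u $ min k l < w $ min k l"
      using k l by (cases k l rule: linorder_cases) (auto simp: min_def)
  qed
qed

text \<open>The index type is finite, so there is a least coordinate at which the vectors differ,
  and it decides the comparison.\<close>

lemma lex_less_total: "u \<noteq> v \<Longrightarrow> lex_less u v \<or> lex_less v u"
proof -
  assume "u \<noteq> v"
  define D where "D = {k. u $ k \<noteq> v $ k}"
  have "D \<noteq> {}" and "finite D"
    using \<open>u \<noteq> v\<close> by (auto simp: D_def vec_eq_iff)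
  then have "Min D \<in> D"
    by simp
  moreover have "p \<notin> D" if "p < Min D" for p
    using Min_le[OF \<open>finite D\<close>, of p] that by (metis leD)
  ultimately have min: "u $ Min D \<noteq> v $ Min D" "\<forall>p<Min D. u $ p = v $ p"
    by (auto simp only: D_def mem_Collect_eq)
  then have "\<forall>p<Min D. v $ p = u $ p"
    by simp
  with min show ?thesis
    unfolding lex_less_def by (metis linorder_neqE)
qed

text \<open>The sorting permutation is the inverse of the rank function.\<close>

lemma ex1_sorting_permutation:
  fixes R :: "nat \<Rightarrow> nat \<Rightarrow> bool"
  assumes irrefl: "\<And>i. \<not> R i i"
    and trans: "\<And>i j k. R i j \<Longrightarrow> R j k \<Longrightarrow> R i k"
    and total: "\<And>i j. i \<in> {1..n} \<Longrightarrow> j \<in> {1..n} \<Longrightarrow> i \<noteq> j \<Longrightarrow> R i j \<or> R j i"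
  shows "\<exists>!\<pi>. \<pi> permutes {1..n} \<and> (\<forall>i\<in>{1..<n}. R (\<pi> i) (\<pi> (Suc i)))"
proof (rule ex_ex1I)
  \<comment> \<open>\<open>Suc\<close> makes the ranks start at 1; outside \<open>{1..n}\<close> the
    identity is what \<open>permutes\<close> demands.\<close>
  define rank where "rank i = (if i \<in> {1..n} then Suc (card {j\<in>{1..n}. R j i}) else i)" for i
  have less: "rank i < rank j" if "R i j" "i \<in> {1..n}" "j \<in> {1..n}" for i j
  proof -
    \<comment> \<open>The inclusion is transitivity. It is strict because \<open>i\<close> lies in
      the right-hand set but, by irreflexivity, not in the left-hand one.\<close>
    have "{k\<in>{1..n}. R k i} \<subset> {k\<in>{1..n}. R k j}"
      using that trans irrefl by blast
    then have "card {k\<in>{1..n}. R k i} < card {k\<in>{1..n}. R k j}"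
      by (intro psubset_card_mono) auto
    then show ?thesis
      using that by (simp add: rank_def)
  qed
  have "rank ` {1..n} \<subseteq> {1..n}"
  proof
    fix y assume "y \<in> rank ` {1..n}"
    then obtain i where i: "i \<in> {1..n}" "y = rank i" by auto
    have "{j\<in>{1..n}. R j i} \<subset> {1..n}"
      using i irrefl by blast
    then have "card {j\<in>{1..n}. R j i} < card {1..n}"
      by (intro psubset_card_mono) auto
    then show "y \<in> {1..n}"
      using i by (simp add: rank_def)
  qed
  moreover have inj: "inj_on rank {1..n}"
    by (rule inj_onI) (metis less total nat_neq_iff)
  ultimately have "bij_betw rank {1..n} {1..n}"
    by (simp add: bij_betw_def endo_inj_surj)
  then have perm: "rank permutes {1..n}"
    by (rule bij_imp_permutes) (auto simp: rank_def)
  show "\<exists>\<pi>. \<pi> permutes {1..n} \<and> (\<forall>i\<in>{1..<n}. R (\<pi> i) (\<pi> (Suc i)))"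
  proof (intro exI[of _ "inv rank"] conjI ballI)
    show inv_perm: "inv rank permutes {1..n}"
      using perm by (rule permutes_inv)
    fix i assume "i \<in> {1..<n}"
    then have mem: "inv rank i \<in> {1..n}" "inv rank (Suc i) \<in> {1..n}"
      using permutes_in_image[OF inv_perm] by auto
    \<comment> \<open>The reversed relation would force \<open>Suc i < i\<close> by
      \<open>less\<close>, so totality leaves only the wanted one.\<close>
    have "rank (inv rank i) = i" "rank (inv rank (Suc i)) = Suc i"
      using permutes_inverses[OF perm] by auto
    then show "R (inv rank i) (inv rank (Suc i))"
      using less[OF _ mem(2,1)] total[OF mem] by (metis n_not_Suc_n not_less_iff_gr_or_eq less_SucI lessI)
  qed
  \<comment> \<open>Uniqueness: in any sorting permutation the entry at position \<open>i\<close>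
    has rank \<open>i\<close>.\<close>
  have eq: "\<pi> = inv rank"
    if \<pi>: "\<pi> permutes {1..n}" and ord: "\<forall>i\<in>{1..<n}. R (\<pi> i) (\<pi> (Suc i))" for \<pi>
  proof -
    have R: "R (\<pi> i) (\<pi> j)" if "i < j" "1 \<le> i" "j \<le> n" for i j
      using that
    proof (induction i j rule: less_Suc_induct)
      case (1 i)
      then show ?case using ord by auto
    next
      case (2 i j k)
      then show ?case using trans[of "\<pi> i" "\<pi> j" "\<pi> k"] by auto
    qed
    have "rank (\<pi> i) = i" for i
    proof (cases "i \<in> {1..n}")
      case True
      \<comment> \<open>The predecessors of the \<open>i\<close>-th entry are the
        \<open>i - 1\<close> entries listed before it, so its rank is
        \<open>Suc (i - 1) = i\<close>.\<close>
      have "{j\<in>{1..n}. R j (\<pi> i)} = \<pi> ` {1..<i}"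
      proof (intro equalityI subsetI)
        fix j assume "j \<in> {j\<in>{1..n}. R j (\<pi> i)}"
        then obtain k where k: "k \<in> {1..n}" "j = \<pi> k" "R (\<pi> k) (\<pi> i)"
          using permutes_image[OF \<pi>] by (metis (no_types, lifting) imageE mem_Collect_eq)
        then have "k < i"
          using R[of i k] True irrefl trans by (metis atLeastAtMost_iff linorder_neqE)
        with k show "j \<in> \<pi> ` {1..<i}" by auto
      next
        fix j assume "j \<in> \<pi> ` {1..<i}"
        then obtain k where "k \<in> {1..<i}" "j = \<pi> k" by auto
        then show "j \<in> {j\<in>{1..n}. R j (\<pi> i)}"
          using True R[of k i] permutes_in_image[OF \<pi>, of k] by auto
      qed
      moreover have "card (\<pi> ` {1..<i}) = i - 1"
        using permutes_inj_on[OF \<pi>] by (subst card_image) auto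
      ultimately show ?thesis
        using True permutes_in_image[OF \<pi>, of i] by (simp add: rank_def)
    next
      case False
      then show ?thesis
        using permutes_not_in[OF \<pi> False] unfolding rank_def by (simp only: if_False)
    qed
    then show ?thesis
      using permutes_inv_eq[OF perm] by (intro ext) metis
  qed
  show "\<pi> = \<sigma>"
    if "\<pi> permutes {1..n} \<and> (\<forall>i\<in>{1..<n}. R (\<pi> i) (\<pi> (Suc i)))"
      "\<sigma> permutes {1..n} \<and> (\<forall>i\<in>{1..<n}. R (\<sigma> i) (\<sigma> (Suc i)))" for \<pi> \<sigma>
    using that eq by metis
qed

text \<open>\<open>LSL_reorder\<close> is defined by \<open>THE\<close>, so its properties become
  available only after existence and uniqueness of the sorting permutation.\<close>

lemma LSL_reorder_permutes:
  fixes t :: "(real, 'd::{finite,linorder}) vec"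
  assumes "inj_on ts {1..n}"
  obtains \<pi> where "\<pi> permutes {1..n}" "LSL_reorder t n ts = ts \<circ> \<pi>"
proof -
  \<comment> \<open>The order on points is pulled back to indices. It is total because
    \<open>ts\<close> is injective: ties in distance are broken lexicographically between distinct
    points.\<close>
  define R where "R i j \<longleftrightarrow> norm (t - ts i) < norm (t - ts j) \<or>
      norm (t - ts i) = norm (t - ts j) \<and> lex_less (ts i) (ts j)" for i j
  have R: "LSL_ordered t n (ts \<circ> \<pi>) \<longleftrightarrow> (\<forall>i\<in>{1..<n}. R (\<pi> i) (\<pi> (Suc i)))" for \<pi>
    by (auto simp: LSL_ordered_def R_def le_less)
  have "\<exists>!\<pi>. \<pi> permutes {1..n} \<and> (\<forall>i\<in>{1..<n}. R (\<pi> i) (\<pi> (Suc i)))"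
  proof (rule ex1_sorting_permutation)
    show "\<not> R i i" for i
      by (simp add: R_def lex_less_irrefl)
    show "R i k" if "R i j" "R j k" for i j k
      using that lex_less_trans by (auto simp: R_def)
    show "R i j \<or> R j i" if "i \<in> {1..n}" "j \<in> {1..n}" "i \<noteq> j" for i j
      using lex_less_total[of "ts i" "ts j"] inj_onD[OF assms, of i j] that
      by (auto simp: R_def)
  qed
  then have "\<exists>!\<pi>. \<pi> permutes {1..n} \<and> LSL_ordered t n (ts \<circ> \<pi>)"
    by (simp only: R)
  from theI'[OF this] show ?thesis
    by (intro that[of "THE \<pi>. \<pi> permutes {1..n} \<and> LSL_ordered t n (ts \<circ> \<pi>)"])
      (auto simp: LSL_reorder_def)
qed


section \<open>The spaces of \<open>\<alpha>\<close>-integrable functions\<close>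

lemma Lalpha_add:
  assumes "0 < \<alpha>" "g \<in> Lalpha \<alpha> m" "h \<in> Lalpha \<alpha> m"
  shows "(\<lambda>x. g x + h x) \<in> Lalpha \<alpha> m"
proof -
  \<comment> \<open>Bounding the sum by twice the maximum avoids the triangle inequality for the
    \<open>\<alpha>\<close>-norm, which can fail when \<alpha> < 1.\<close>
  have bound: "\<bar>a + b\<bar> powr \<alpha> \<le> 2 powr \<alpha> * (\<bar>a\<bar> powr \<alpha> + \<bar>b\<bar> powr \<alpha>)" for a b :: real
  proof -
    have "\<bar>a + b\<bar> powr \<alpha> \<le> (2 * max \<bar>a\<bar> \<bar>b\<bar>) powr \<alpha>"
      using assms(1) by (intro powr_mono2) auto
    also have "\<dots> = 2 powr \<alpha> * max \<bar>a\<bar> \<bar>b\<bar> powr \<alpha>"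
      by (simp add: powr_mult)
    also have "\<dots> \<le> 2 powr \<alpha> * (\<bar>a\<bar> powr \<alpha> + \<bar>b\<bar> powr \<alpha>)"
      by (intro mult_left_mono) (auto simp: max_def)
    finally show ?thesis .
  qed
  have [measurable]: "g \<in> borel_measurable m" "h \<in> borel_measurable m"
    using assms by (auto simp: Lalpha_def)
  have "integrable m (\<lambda>x. 2 powr \<alpha> * (\<bar>g x\<bar> powr \<alpha> + \<bar>h x\<bar> powr \<alpha>))"
    using assms by (auto simp: Lalpha_def)
  then have "integrable m (\<lambda>x. \<bar>g x + h x\<bar> powr \<alpha>)"
    by (rule Bochner_Integration.integrable_bound) (use bound in auto)
  then show ?thesis
    by (simp add: Lalpha_def)
qed

lemma Lalpha_scale:
  assumes "g \<in> Lalpha \<alpha> m"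
  shows "(\<lambda>x. c * g x) \<in> Lalpha \<alpha> m"
proof -
  have "integrable m (\<lambda>x. \<bar>c\<bar> powr \<alpha> * \<bar>g x\<bar> powr \<alpha>)"
    using assms by (simp add: Lalpha_def)
  then show ?thesis
    using assms by (auto simp: Lalpha_def abs_mult powr_mult intro: borel_measurable_times)
qed

lemma Lalpha_sum:
  assumes "0 < \<alpha>" "\<And>i. i \<in> I \<Longrightarrow> g i \<in> Lalpha \<alpha> m"
  shows "(\<lambda>x. \<Sum>i\<in>I. g i x) \<in> Lalpha \<alpha> m"
  using assms(2)
proof (induction I rule: infinite_finite_induct)
  case (insert i I)
  then have "(\<lambda>x. g i x + (\<Sum>i\<in>I. g i x)) \<in> Lalpha \<alpha> m"
    by (intro Lalpha_add[OF assms(1)]) auto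
  with insert.hyps show ?case
    by simp
qed (auto simp: Lalpha_def)

text \<open>Membership in \<open>Lalpha\<close> supplies integrability; the integral of a
  non-integrable function would be 0 by default.\<close>

lemma Lalpha_integral_eq_0_iff:
  assumes "g \<in> Lalpha \<alpha> m"
  shows "(LINT x|m. \<bar>g x\<bar> powr \<alpha>) = 0 \<longleftrightarrow> (AE x in m. g x = 0)"
proof -
  have "(LINT x|m. \<bar>g x\<bar> powr \<alpha>) = 0 \<longleftrightarrow> (AE x in m. \<bar>g x\<bar> powr \<alpha> = 0)"
    using assms by (intro integral_nonneg_eq_0_iff_AE) (simp_all add: Lalpha_def)
  then show ?thesis
    by simp
qed


section \<open>Linear independence and the criterion\<close>

lemma lin_indep_AE_inj_on:
  assumes "lin_indep_AE m n (\<lambda>i. f (ts i))"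
  shows "inj_on ts {1..n}"
proof (rule inj_onI, rule ccontr)
  fix i j assume ij: "i \<in> {1..n}" "j \<in> {1..n}" "ts i = ts j" "i \<noteq> j"
  \<comment> \<open>A repeated point yields a nontrivial vanishing combination, with coefficient 1
    at \<open>i\<close> and -1 at \<open>j\<close>.\<close>
  define c :: "nat \<Rightarrow> real" where "c k = of_bool (k = i) - of_bool (k = j)" for k
  have "(\<Sum>k=1..n. c k * f (ts k) x) = 0" for x
  proof -
    have "(\<Sum>k=1..n. c k * f (ts k) x) =
        (\<Sum>k=1..n. (if k = i then f (ts k) x else 0) - (if k = j then f (ts k) x else 0))"
      by (intro sum.cong) (auto simp: c_def)
    then show ?thesis
      using ij by (simp add: sum_subtractf)
  qed
  then have "c i = 0"
    using assms ij unfolding lin_indep_AE_def by auto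
  then show False
    using ij by (simp add: c_def)
qed

lemma lin_indep_AE_permute:
  assumes "lin_indep_AE m n g" "\<pi> permutes {1..n}"
  shows "lin_indep_AE m n (\<lambda>i. g (\<pi> i))"
  unfolding lin_indep_AE_def
proof (intro allI impI ballI)
  fix c :: "nat \<Rightarrow> real" and i
  assume c: "AE x in m. (\<Sum>i=1..n. c i * g (\<pi> i) x) = 0" and i: "i \<in> {1..n}"
  \<comment> \<open>A combination of the permuted family is one of the original family with
    coefficients moved along \<open>inv \<pi>\<close>.\<close>
  have "(\<Sum>i=1..n. c (inv \<pi> i) * g i x) = (\<Sum>i=1..n. c i * g (\<pi> i) x)" for x
    using sum.permute[OF assms(2), of "\<lambda>i. c (inv \<pi> i) * g i x"] permutes_inverses[OF assms(2)]
    by (simp add: o_def)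
  with c have "AE x in m. (\<Sum>i=1..n. c (inv \<pi> i) * g i x) = 0"
    by simp
  then have "\<forall>i\<in>{1..n}. c (inv \<pi> i) = 0"
    using assms(1) unfolding lin_indep_AE_def by (elim allE[of _ "\<lambda>i. c (inv \<pi> i)"] impE)
  moreover have "\<pi> i \<in> {1..n}"
    using permutes_in_image[OF assms(2)] i by simp
  ultimately have "c (inv \<pi> (\<pi> i)) = 0"
    by blast
  then show "c i = 0"
    by (simp only: permutes_inverses(2)[OF assms(2)])
qed

text \<open>The restriction to \<open>{1..n}\<close> makes the vector extensional, hence an element
  of \<open>Rn n\<close>.\<close>

definition unit_coeff :: "nat \<Rightarrow> nat \<Rightarrow> nat \<Rightarrow> real" where
  "unit_coeff n j = (\<lambda>i\<in>{1..n}. of_bool (i = j))"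

lemma sum_unit_coeff:
  assumes "j \<in> {1..n}"
  shows "(\<Sum>i=1..n. unit_coeff n j i * g i) = g j"
proof -
  have "(\<Sum>i=1..n. unit_coeff n j i * g i) = (\<Sum>i=1..n. if i = j then g i else 0)"
    by (intro sum.cong) (auto simp: unit_coeff_def)
  then show ?thesis
    using assms by simp
qed

text \<open>The prediction error at \<open>q j\<close> is itself a combination of the
  \<open>f (q i)\<close>, with coefficients \<open>unit_coeff n j i - l i\<close>; independence
  forces them all to vanish when the error is null.\<close>

lemma LSL_H_eq_0_iff:
  assumes "0 < \<alpha>" "\<And>i. i \<in> {1..n} \<Longrightarrow> f (q i) \<in> Lalpha \<alpha> m"
    and indep: "lin_indep_AE m n (\<lambda>i. f (q i))" and j: "j \<in> {1..n}" and l: "l \<in> Rn n"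
  shows "LSL_H \<alpha> m f (q j) n q l = 0 \<longleftrightarrow> l = unit_coeff n j"
proof -
  define c where "c i = unit_coeff n j i - l i" for i
  have c: "f (q j) x - (\<Sum>i=1..n. l i * f (q i) x) = (\<Sum>i=1..n. c i * f (q i) x)" for x
    using sum_unit_coeff[OF j, of "\<lambda>i. f (q i) x"]
    by (simp add: c_def left_diff_distrib sum_subtractf)
  have "(\<lambda>x. \<Sum>i=1..n. c i * f (q i) x) \<in> Lalpha \<alpha> m"
    using assms by (intro Lalpha_sum Lalpha_scale) auto
  then have "LSL_H \<alpha> m f (q j) n q l = 0 \<longleftrightarrow> (AE x in m. (\<Sum>i=1..n. c i * f (q i) x) = 0)"
    unfolding LSL_H_def c by (simp add: Lalpha_integral_eq_0_iff)
  also have "\<dots> \<longleftrightarrow> (\<forall>i\<in>{1..n}. c i = 0)"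
    using indep unfolding lin_indep_AE_def by auto
  also have "\<dots> \<longleftrightarrow> l = unit_coeff n j"
  proof
    assume "\<forall>i\<in>{1..n}. c i = 0"
    then show "l = unit_coeff n j"
      using l by (intro PiE_ext[of _ "{1..n}" "\<lambda>_. UNIV"]) (auto simp: c_def unit_coeff_def)
  qed (simp add: c_def)
  finally show ?thesis .
qed

lemma LSL_A_eq_unit_coeff:
  assumes "0 < \<alpha>" "\<And>i. i \<in> {1..n} \<Longrightarrow> f (q i) \<in> Lalpha \<alpha> m"
    and "lin_indep_AE m n (\<lambda>i. f (q i))" "j \<in> {1..n}"
  shows "LSL_A \<alpha> m f (q j) n q k = {unit_coeff n j}"
proof (induction k)
  case 0
  have zero: "LSL_H \<alpha> m f (q j) n q l = 0 \<longleftrightarrow> l = unit_coeff n j" if "l \<in> Rn n" for l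
    using assms that by (intro LSL_H_eq_0_iff)
  have unit: "unit_coeff n j \<in> Rn n"
    by (auto simp: unit_coeff_def)
  have "(INF u\<in>Rn n. LSL_H \<alpha> m f (q j) n q u) = 0"
  \<comment> \<open>The criterion is nonnegative, being a \<open>powr\<close>, and takes the value 0
    at the unit vector, so the infimum is an attained minimum. Later maximizations act on a
    singleton.\<close>
  proof (rule cInf_eq_minimum)
    show "0 \<in> LSL_H \<alpha> m f (q j) n q ` Rn n"
      using zero[OF unit] unit by (metis imageI)
  qed (auto simp: LSL_H_def)
  then show ?case
    using zero unit by auto
qed auto


section \<open>Exactness\<close>

theorem mainTheorem8:
  fixes P :: "'w measure" and m :: "'e measure" and \<alpha> :: real
    and \<beta> :: "'e \<Rightarrow> real" and M :: "'e set \<Rightarrow> 'w \<Rightarrow> real"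
    and T :: "(real, 'd::{finite,linorder}) vec set"
    and f :: "(real, 'd) vec \<Rightarrow> 'e \<Rightarrow> real" and X :: "(real, 'd) vec \<Rightarrow> 'w \<Rightarrow> real"
    and n :: nat and ts :: "nat \<Rightarrow> (real, 'd) vec" and t :: "(real, 'd) vec"
  assumes "prob_space P"
    and "sigma_finite_measure m"
    and "0 < \<alpha>" and "\<alpha> < 1"
    and "stable_random_measure P m \<alpha> \<beta> M"
    and "\<forall>s\<in>T. f s \<in> Lalpha \<alpha> m"
    and "\<forall>s\<in>T. has_stable_integral P m \<alpha> M (f s) (X s)"
    and "\<forall>i\<in>{1..n}. ts i \<in> T"
    and "lin_indep_AE m n (\<lambda>i. f (ts i))"
    and "\<exists>i\<in>{1..n}. t = ts i"
  shows "AE \<omega> in P. best_LSL_predictor \<alpha> m f X n ts t \<omega> = X t \<omega>"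
proof -
  have f_in: "f (ts i) \<in> Lalpha \<alpha> m" if "i \<in> {1..n}" for i
    using assms(6,8) that by auto
  obtain \<pi> where \<pi>: "\<pi> permutes {1..n}" and q: "LSL_reorder t n ts = ts \<circ> \<pi>"
    using LSL_reorder_permutes[OF lin_indep_AE_inj_on[of m n f ts, OF assms(9)]] by metis
  define q where "q = ts \<circ> \<pi>"
  \<comment> \<open>\<open>\<pi>\<close> maps onto \<open>{1..n}\<close>, so the known point
    \<open>t\<close> reappears in the reordered list, at a possibly different index.\<close>
  obtain j where j: "j \<in> {1..n}" "t = q j"
    using assms(10) permutes_image[OF \<pi>] unfolding q_def by (metis imageE comp_apply)
  have "LSL_A \<alpha> m f (q j) n q n = {unit_coeff n j}"
    using f_in permutes_in_image[OF \<pi>] lin_indep_AE_permute[OF assms(9) \<pi>] j assms(3)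
    by (intro LSL_A_eq_unit_coeff) (auto simp: q_def)
  then have "LSL_coeff \<alpha> m f t n q = unit_coeff n j"
    by (simp add: LSL_coeff_def j)
  \<comment> \<open>Unit coefficients select \<open>X (q j)\<close>, so the equality holds at every
    \<omega>.\<close>
  with q have "best_LSL_predictor \<alpha> m f X n ts t \<omega> = X t \<omega>" for \<omega>
    using sum_unit_coeff[OF j(1), of "\<lambda>i. X (q i) \<omega>"] j(2)
    by (simp add: best_LSL_predictor_def flip: q_def)
  then show ?thesis
    by simp
qed

end
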